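(* Let $\mathbb{F}_q$ be a finite field, let $n\ge 1$ and $t\ge 2$ be integers, let $A$ be a symmetric $n\times n$ matrix over $\mathbb{F}_q$ (i.e. $A^T=A$), and let $\lambda_1,\dots,\lambda_n$ be the eigenvalues of $A$. Let $f_1,\dots,f_{t-1}\in\mathbb{F}_q[x]$ and let $C$ be the linear code over $\mathbb{F}_q$ with generator matrix $(I_n\ f_1(A)\ f_2(A)\ \cdots\ f_{t-1}(A))$. Then: (1) If $\operatorname{char}\mathbb{F}_q$ is even, then $C$ is Euclidean LCD if and only if $$1\notin\{f_1(\lambda_i)+f_2(\lambda_i)+\cdots+f_{t-1}(\lambda_i):\ 1\le i\le n\}.$$ (2) If $\operatorname{char}\mathbb{F}_q$ is odd, then $C$ is Euclidean LCD if and only if $$-1\notin\{f_1(\lambda_i)^2+f_2(\lambda_i)^2+\cdots+f_{t-1}(\lambda_i)^2:\ 1\le i\le n\}.$$ In particular, when $t=2$ (and $\operatorname{char}\mathbb{F}_q$ is odd), $C$ is Euclidean LCD if and only if $$\mu\notin\{f_1(\lambda_i):1\le i\le n\}\cup\{-f_1(\lambda_i):1\le i\le n\},$$ where $\mu\in\mathbb{F}_{q^2}$ satisfies $\mu^2=-1$.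
   Context: $I_n$ is the $n\times n$ identity matrix. Eigenvalues are taken in an algebraic closure of $\mathbb{F}_q$ and listed with algebraic multiplicity. For a linear code $C\subseteq\mathbb{F}_q^N$ (a linear subspace), its Euclidean dual is $C^{\perp_E}=\{y\in\mathbb{F}_q^N:\sum_{i=1}^N x_iy_i=0 \text{ for all } x\in C\}$. $C$ is Euclidean LCD (linear complementary dual) if $C\cap C^{\perp_E}=\{0\}$. The code with generator matrix $G$ is the row space of $G$. *)

theory Defs
  imports
    "HOL-Library.Cardinality"
    "HOL-Algebra.Algebraic_Closure_Type"
    "Jordan_Normal_Form.Char_Poly"
    "Jordan_Normal_Form.VS_Connect"
begin

text \<open>
  The sum \<open>\<Sum>i. coeff p i \<cdot>\<^sub>m A ^\<^sub>m i\<close> is written entrywise, because matrices with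
  explicit dimensions do not form a type-class monoid.
\<close>
definition mat_poly_eval :: "'a :: comm_ring_1 poly \<Rightarrow> 'a mat \<Rightarrow> 'a mat" where
  "mat_poly_eval p A =
     mat (dim_row A) (dim_row A) (\<lambda>ij. \<Sum>k\<le>degree p. coeff p k * (A ^\<^sub>m k) $$ ij)"

text \<open>
  The \<open>n \<times> (t * n)\<close> block matrix \<open>(I\<^sub>n  f\<^sub>1(A)  \<dots>  f\<^sub>t\<^sub>-\<^sub>1(A))\<close> with \<open>n = dim_row A\<close>;
  column \<open>j\<close> is column \<open>j mod n\<close> of block \<open>j div n\<close>, and only \<open>f 1, \<dots>, f (t - 1)\<close> are used.
\<close>
definition poly_block_mat ::
    "nat \<Rightarrow> (nat \<Rightarrow> 'a :: comm_ring_1 poly) \<Rightarrow> 'a mat \<Rightarrow> 'a mat" where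
  "poly_block_mat t f A =
     (let n = dim_row A;
          B = (\<lambda>k. if k = 0 then 1\<^sub>m n else mat_poly_eval (f k) A)
      in mat n (t * n) (\<lambda>(i, j). B (j div n) $$ (i, j mod n)))"

definition code_of_generator_mat :: "'a :: field mat \<Rightarrow> 'a vec set" where
  "code_of_generator_mat G = vec_space.row_space (dim_col G) G"

text \<open>
  The library's \<open>orthogonal_complement\<close> is taken with respect to the bilinear form
  \<open>x \<bullet> y = (\<Sum>i. x $ i * y $ i)\<close>, without conjugation.
\<close>
abbreviation euclidean_dual :: "nat \<Rightarrow> 'a :: field vec set \<Rightarrow> 'a vec set" where
  "euclidean_dual N C \<equiv> vec_module.orthogonal_complement N C"

definition euclidean_LCD :: "nat \<Rightarrow> 'a :: field vec set \<Rightarrow> bool" where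
  "euclidean_LCD N C \<longleftrightarrow> C \<inter> euclidean_dual N C = {0\<^sub>v N}"

text \<open>
  \<open>l 1, \<dots>, l n\<close> are the eigenvalues of the \<open>n \<times> n\<close> matrix \<open>A\<close> in the algebraic closure,
  listed with algebraic multiplicity.
\<close>
definition eigenvalues_listed ::
    "'a :: field mat \<Rightarrow> (nat \<Rightarrow> 'a alg_closure) \<Rightarrow> bool" where
  "eigenvalues_listed A l \<longleftrightarrow>
     char_poly (map_mat to_ac A) = (\<Prod>i=1..dim_row A. [:- l i, 1:])"

abbreviation poly_ac :: "'a :: field poly \<Rightarrow> 'a alg_closure \<Rightarrow> 'a alg_closure" where
  "poly_ac p \<equiv> poly (map_poly to_ac p)"

text \<open>
  For a finite field with \<open>q\<close> elements, the field with \<open>q\<^sup>2\<close> elements is the set of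
  fixed points of \<open>x \<mapsto> x\<^bsup>q\<^sup>2\<^esup>\<close> in the algebraic closure.
\<close>
definition quadratic_extension :: "'a :: {field, finite} alg_closure set" where
  "quadratic_extension = {x. x ^ (CARD('a)\<^sup>2) = x}"

end

theory Submission
  imports Defs
begin

text \<open>
  The block \<open>I\<^sub>n\<close> gives the generator matrix \<open>G\<close> full row rank, so the code is LCD iff
  \<open>G G\<^sup>T\<close> is invertible. As \<open>A\<close> is symmetric, \<open>G G\<^sup>T = g(A)\<close> for
  \<open>g = 1 + f\<^sub>1\<^sup>2 + \<dots> + f\<^sub>t\<^sub>-\<^sub>1\<^sup>2\<close>. Factoring \<open>g\<close> into linear factors over the algebraic closure
  shows that \<open>g(A)\<close> is singular iff some factor \<open>A - a I\<^sub>n\<close> with \<open>g(a) = 0\<close> is, i.e. iff \<open>g\<close> vanishes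
  at an eigenvalue of \<open>A\<close>. In characteristic 2, \<open>g = (1 + f\<^sub>1 + \<dots> + f\<^sub>t\<^sub>-\<^sub>1)\<^sup>2\<close>.
\<close>

section \<open>Evaluation of polynomials at a square matrix\<close>

interpretation to_ac: inj_comm_ring_hom to_ac
  by unfold_locales simp_all

interpretation to_ac_poly: map_poly_comm_ring_hom to_ac ..

lemma mat_poly_eval_carrier [simp]:
  "A \<in> carrier_mat n n \<Longrightarrow> mat_poly_eval p A \<in> carrier_mat n n"
  by (auto simp: mat_poly_eval_def)

lemma dim_mat_poly_eval [simp]:
  "dim_row (mat_poly_eval p A) = dim_row A" "dim_col (mat_poly_eval p A) = dim_row A"
  by (simp_all add: mat_poly_eval_def)

text \<open>Coefficients beyond the degree vanish, so the sum may run to any larger bound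
  \<open>m\<close>; a common \<open>m\<close> lets polynomials of different degrees be compared
  entrywise.\<close>

lemma index_mat_poly_eval:
  assumes "A \<in> carrier_mat n n" "i < n" "j < n" "degree p \<le> m"
  shows "mat_poly_eval p A $$ (i, j) = (\<Sum>k\<le>m. coeff p k * (A ^\<^sub>m k) $$ (i, j))"
  using assms
  by (auto simp: mat_poly_eval_def le_degree intro!: sum.mono_neutral_left dest!: mult_not_zero)

lemma mat_poly_eval_0: "A \<in> carrier_mat n n \<Longrightarrow> mat_poly_eval 0 A = 0\<^sub>m n n"
  by (auto simp: mat_poly_eval_def)

lemma mat_poly_eval_const:
  "A \<in> carrier_mat n n \<Longrightarrow> mat_poly_eval [:c:] A = c \<cdot>\<^sub>m 1\<^sub>m n"
  by (auto simp: mat_poly_eval_def)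

lemma mat_poly_eval_1: "A \<in> carrier_mat n n \<Longrightarrow> mat_poly_eval 1 A = 1\<^sub>m n"
  by (auto simp: one_pCons mat_poly_eval_const)

lemma mat_poly_eval_add:
  assumes A: "A \<in> carrier_mat n n"
  shows "mat_poly_eval (p + q) A = mat_poly_eval p A + mat_poly_eval q A"
proof (rule eq_matI)
  fix i j assume "i < dim_row (mat_poly_eval p A + mat_poly_eval q A)"
    "j < dim_col (mat_poly_eval p A + mat_poly_eval q A)"
  then have ij: "i < n" "j < n"
    using mat_poly_eval_carrier[OF A, of q] by auto
  define m where "m = max (degree p) (degree q)"
  have "degree p \<le> m" "degree q \<le> m" "degree (p + q) \<le> m"
    by (auto simp: m_def degree_add_le)
  then show "mat_poly_eval (p + q) A $$ (i, j) = (mat_poly_eval p A + mat_poly_eval q A) $$ (i, j)"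
    using ij mat_poly_eval_carrier[OF A, of q]
    by (auto simp: index_mat_poly_eval[OF A ij] sum.distrib algebra_simps)
qed (use A in auto)

lemma mat_poly_eval_smult:
  assumes A: "A \<in> carrier_mat n n"
  shows "mat_poly_eval (smult c p) A = c \<cdot>\<^sub>m mat_poly_eval p A"
proof (rule eq_matI)
  fix i j assume "i < dim_row (c \<cdot>\<^sub>m mat_poly_eval p A)" "j < dim_col (c \<cdot>\<^sub>m mat_poly_eval p A)"
  then have ij: "i < n" "j < n"
    using mat_poly_eval_carrier[OF A, of p] by auto
  then show "mat_poly_eval (smult c p) A $$ (i, j) = (c \<cdot>\<^sub>m mat_poly_eval p A) $$ (i, j)"
    using mat_poly_eval_carrier[OF A, of p]
    by (auto simp: index_mat_poly_eval[OF A ij, of _ "degree p"] sum_distrib_left degree_smult_le mult.assoc)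
qed (use A in auto)

text \<open>Horner's rule. It replaces the explicit power sum in the later inductions over
  \<open>pCons\<close>.\<close>

lemma mat_poly_eval_pCons:
  assumes A: "A \<in> carrier_mat n n"
  shows "mat_poly_eval (pCons c p) A = c \<cdot>\<^sub>m 1\<^sub>m n + mat_poly_eval p A * A"
proof (rule eq_matI)
  note P = mat_poly_eval_carrier[OF A, of p]
  fix i j assume "i < dim_row (c \<cdot>\<^sub>m 1\<^sub>m n + mat_poly_eval p A * A)"
    "j < dim_col (c \<cdot>\<^sub>m 1\<^sub>m n + mat_poly_eval p A * A)"
  then have ij: "i < n" "j < n"
    using P A by auto
  have pow: "(A ^\<^sub>m Suc k) $$ (i, j) = (\<Sum>m<n. (A ^\<^sub>m k) $$ (i, m) * A $$ (m, j))" for k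
    using A ij by (auto simp: scalar_prod_def atLeast0LessThan)
  have "(mat_poly_eval p A * A) $$ (i, j) = (\<Sum>m<n. mat_poly_eval p A $$ (i, m) * A $$ (m, j))"
    using A ij by (auto simp: scalar_prod_def atLeast0LessThan)
  also have "\<dots> = (\<Sum>m<n. \<Sum>k\<le>degree p. coeff p k * (A ^\<^sub>m k) $$ (i, m) * A $$ (m, j))"
    using ij by (auto simp: index_mat_poly_eval[OF A _ _ order.refl] sum_distrib_right)
  also have "\<dots> = (\<Sum>k\<le>degree p. coeff p k * (A ^\<^sub>m Suc k) $$ (i, j))"
    unfolding pow by (subst sum.swap) (simp add: sum_distrib_left mult.assoc)
  finally have PA: "(mat_poly_eval p A * A) $$ (i, j) = \<dots>" .
  have "mat_poly_eval (pCons c p) A $$ (i, j) =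
      (\<Sum>k\<le>Suc (degree p). coeff (pCons c p) k * (A ^\<^sub>m k) $$ (i, j))"
    by (rule index_mat_poly_eval[OF A ij]) (simp add: degree_pCons_le)
  \<comment> \<open>The term for k = 0 gives \<open>c\<close> times the identity; the remaining
    terms, shifted by one, are the sum in \<open>PA\<close>.\<close>
  also have "\<dots> = c * (1\<^sub>m n) $$ (i, j) + (mat_poly_eval p A * A) $$ (i, j)"
    unfolding PA sum.atMost_Suc_shift using A by simp
  finally show "mat_poly_eval (pCons c p) A $$ (i, j) =
      (c \<cdot>\<^sub>m 1\<^sub>m n + mat_poly_eval p A * A) $$ (i, j)"
    using ij P A by simp
qed (use A in auto)

lemma mat_poly_eval_pCons_0:
  assumes A: "A \<in> carrier_mat n n"
  shows "mat_poly_eval (pCons 0 p) A = mat_poly_eval p A * A"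
  unfolding mat_poly_eval_pCons[OF A] using A by (intro eq_matI) auto

text \<open>Horner's rule puts \<open>A\<close> on the right; products and transposes of such values
  need it on the left.\<close>

lemma mat_poly_eval_commute:
  assumes A: "A \<in> carrier_mat n n"
  shows "mat_poly_eval p A * A = A * mat_poly_eval p A"
proof (induction p)
  case 0
  then show ?case using A by (simp add: mat_poly_eval_0[OF A])
next
  case (pCons c p)
  note P = mat_poly_eval_carrier[OF A, of p]
  have "(mat_poly_eval (pCons c p) A) * A = c \<cdot>\<^sub>m A + mat_poly_eval p A * A * A"
    unfolding mat_poly_eval_pCons[OF A]
    by (subst add_mult_distrib_mat[of _ n n])
      (use A mult_carrier_mat[OF P A] in \<open>auto simp: mult_smult_assoc_mat[of _ n n]\<close>)
  also have "mat_poly_eval p A * A * A = A * (mat_poly_eval p A * A)"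
    by (subst pCons.IH) (rule assoc_mult_mat[OF A P A])
  also have "c \<cdot>\<^sub>m A + A * (mat_poly_eval p A * A) = A * mat_poly_eval (pCons c p) A"
    unfolding mat_poly_eval_pCons[OF A]
    by (subst mult_add_distrib_mat[of _ n n]) (use A P in \<open>auto simp: mult_smult_distrib[OF A]\<close>)
  finally show ?case .
qed

text \<open>Horner's rule in the first factor leaves an \<open>A\<close> on the far right, which
  must pass \<open>mat_poly_eval q A\<close>; the two commute.\<close>

lemma mat_poly_eval_mult:
  assumes A: "A \<in> carrier_mat n n"
  shows "mat_poly_eval (p * q) A = mat_poly_eval p A * mat_poly_eval q A"
proof (induction p)
  case 0
  then show ?case by (simp add: mat_poly_eval_0[OF A] left_mult_zero_mat[OF mat_poly_eval_carrier[OF A]])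
next
  case (pCons c p)
  note P = mat_poly_eval_carrier[OF A, of p] and Q = mat_poly_eval_carrier[OF A, of q]
  have "mat_poly_eval (pCons c p * q) A =
      c \<cdot>\<^sub>m mat_poly_eval q A + mat_poly_eval p A * mat_poly_eval q A * A"
    using P Q A by (simp add: mat_poly_eval_add[OF A] mat_poly_eval_smult[OF A]
        mat_poly_eval_pCons_0[OF A] pCons.IH[symmetric])
  also have "mat_poly_eval p A * mat_poly_eval q A * A = mat_poly_eval p A * A * mat_poly_eval q A"
    unfolding assoc_mult_mat[OF P Q A] assoc_mult_mat[OF P A Q] mat_poly_eval_commute[OF A, of q] ..
  also have "c \<cdot>\<^sub>m mat_poly_eval q A + mat_poly_eval p A * A * mat_poly_eval q A =
      mat_poly_eval (pCons c p) A * mat_poly_eval q A"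
    unfolding mat_poly_eval_pCons[OF A]
    using add_mult_distrib_mat[OF smult_carrier_mat[OF one_carrier_mat] mult_carrier_mat[OF P A] Q, of c]
    by (simp only: mult_smult_assoc_mat[OF one_carrier_mat Q] left_mult_one_mat[OF Q])
  finally show ?case .
qed

lemma index_mat_poly_eval_sum:
  assumes A: "A \<in> carrier_mat n n" and ij: "i < n" "j < n"
  shows "mat_poly_eval (\<Sum>k\<in>K. p k) A $$ (i, j) = (\<Sum>k\<in>K. mat_poly_eval (p k) A $$ (i, j))"
  using ij A
  by (induction K rule: infinite_finite_induct) (auto simp: mat_poly_eval_0[OF A] mat_poly_eval_add[OF A])

text \<open>Transposition reverses the product in Horner's rule, and commutation restores the order.
  For symmetric \<open>A\<close> every value is thus symmetric.\<close>

lemma transpose_mat_poly_eval: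
  assumes A: "A \<in> carrier_mat n n"
  shows "(mat_poly_eval p A)\<^sup>T = mat_poly_eval p (A\<^sup>T)"
proof (induction p)
  case 0
  then show ?case using A by (simp add: mat_poly_eval_0[of _ n])
next
  case (pCons c p)
  have A': "A\<^sup>T \<in> carrier_mat n n" using A by simp
  note P = mat_poly_eval_carrier[OF A, of p] and P' = mat_poly_eval_carrier[OF A', of p]
  have 1: "(c \<cdot>\<^sub>m 1\<^sub>m n)\<^sup>T = c \<cdot>\<^sub>m 1\<^sub>m n"
    by (rule eq_matI) auto
  have "(mat_poly_eval (pCons c p) A)\<^sup>T = c \<cdot>\<^sub>m 1\<^sub>m n + A\<^sup>T * mat_poly_eval p (A\<^sup>T)"
    unfolding mat_poly_eval_pCons[OF A]
    by (subst transpose_add[of _ n n])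
      (use A mult_carrier_mat[OF P A] in \<open>auto simp: transpose_mult[OF P A] pCons.IH 1\<close>)
  then show ?case
    by (simp add: mat_poly_eval_pCons[OF A'] mat_poly_eval_commute[OF A'])
qed

text \<open>Horner's rule uses only sums and products, which \<open>hom\<close> preserves. This
  carries values over to the algebraic closure.\<close>

lemma (in comm_ring_hom) mat_poly_eval_hom:
  assumes A: "A \<in> carrier_mat n n"
  shows "mat_poly_eval (map_poly hom p) (map_mat hom A) = map_mat hom (mat_poly_eval p A)"
proof (induction p)
  case 0
  then show ?case using A by (auto simp: mat_poly_eval_0[of _ n])
next
  case (pCons c p)
  have A': "map_mat hom A \<in> carrier_mat n n" using A by simp
  have "map_mat hom (c \<cdot>\<^sub>m 1\<^sub>m n + mat_poly_eval p A * A) =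
      hom c \<cdot>\<^sub>m 1\<^sub>m n + map_mat hom (mat_poly_eval p A * A)"
    using A by (intro eq_matI) (auto simp: hom_distribs)
  then show ?case
    by (simp add: mat_poly_eval_pCons[OF A] mat_poly_eval_pCons[OF A'] map_poly_pCons_hom
        mat_hom_mult[OF mat_poly_eval_carrier[OF A] A] pCons.IH)
qed

section \<open>Singularity of polynomials in a matrix, in terms of eigenvalues\<close>

text \<open>Each root \<open>a\<close> splits off a linear factor whose value at \<open>A\<close> is
  \<open>char_matrix A a\<close>, singular exactly for eigenvalues; \<open>det\<close> is
  multiplicative, so induction on the degree applies.\<close>

lemma det_mat_poly_eval_eq_0_iff:
  fixes A :: "'a :: alg_closed_field mat"
  assumes A: "A \<in> carrier_mat n n" and "p \<noteq> 0"
  shows "det (mat_poly_eval p A) = 0 \<longleftrightarrow> (\<exists>a. eigenvalue A a \<and> poly p a = 0)"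
  using \<open>p \<noteq> 0\<close>
proof (induction "degree p" arbitrary: p)
  case 0
  \<comment> \<open>A nonzero constant has no root, and its value is an invertible scalar
    matrix.\<close>
  then obtain c where "p = [:c:]" "c \<noteq> 0"
    by (metis degree_eq_zeroE pCons_0_0)
  then show ?case by (simp add: mat_poly_eval_const[OF A])
next
  case (Suc d)
  then obtain a where "poly p a = 0"
    using alg_closed_imp_poly_has_root[of p] by auto
  then obtain q where p: "p = [:- a, 1:] * q"
    by (auto simp: poly_eq_0_iff_dvd)
  with Suc.prems have "q \<noteq> 0" by auto
  then have "degree p = Suc (degree q)"
    unfolding p by (subst degree_mult_eq) auto
  with Suc.hyps(2) have "d = degree q" by simp
  then have IH: "det (mat_poly_eval q A) = 0 \<longleftrightarrow> (\<exists>a. eigenvalue A a \<and> poly q a = 0)"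
    using Suc.hyps(1) \<open>q \<noteq> 0\<close> by blast
  have "mat_poly_eval [:- a, 1:] A = char_matrix A a"
    using A by (auto simp: mat_poly_eval_pCons[OF A] mat_poly_eval_0[OF A] char_matrix_def)
  then have "det (mat_poly_eval p A) = det (char_matrix A a) * det (mat_poly_eval q A)"
    unfolding p mat_poly_eval_mult[OF A] using A
    by (simp add: det_mult[of _ n])
  then show ?case
    using IH by (auto simp: p eigenvalue_det[OF A])
qed

text \<open>The injective \<open>to_ac\<close> preserves and reflects vanishing of the determinant,
  so the criterion over the closure applies; there the eigenvalues are the roots of the
  characteristic polynomial, that is, the \<open>l i\<close>.\<close>

lemma det_mat_poly_eval_eq_0_iff_listed:
  fixes A :: "'a :: field mat"
  assumes A: "A \<in> carrier_mat n n" and "n \<ge> 1" and l: "eigenvalues_listed A l"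
  shows "det (mat_poly_eval p A) = 0 \<longleftrightarrow> (\<exists>i. 1 \<le> i \<and> i \<le> n \<and> poly_ac p (l i) = 0)"
proof (cases "p = 0")
  case True
  \<comment> \<open>Both sides are true: the zero matrix of size \<open>n\<close> \<ge> 1 is
    singular, and index 1 is a witness on the right.\<close>
  then show ?thesis using A \<open>n \<ge> 1\<close> by (auto simp: mat_poly_eval_0)
next
  case False
  have A': "map_mat to_ac A \<in> carrier_mat n n" using A by simp
  have ev: "eigenvalue (map_mat to_ac A) a \<longleftrightarrow> (\<exists>i. 1 \<le> i \<and> i \<le> n \<and> a = l i)" for a
    using l A by (auto simp: eigenvalue_root_char_poly[OF A'] eigenvalues_listed_def poly_prod)
  have "det (mat_poly_eval p A) = 0 \<longleftrightarrow> det (map_mat to_ac (mat_poly_eval p A)) = 0"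
    by simp
  also have "\<dots> \<longleftrightarrow> (\<exists>a. eigenvalue (map_mat to_ac A) a \<and> poly_ac p a = 0)"
    unfolding to_ac.mat_poly_eval_hom[OF A, symmetric]
    by (rule det_mat_poly_eval_eq_0_iff[OF A']) (use False in simp)
  finally show ?thesis
    by (auto simp: ev)
qed

section \<open>LCD codes and the Gram matrix of a generator matrix\<close>

text \<open>By injectivity, nonzero codewords are the \<open>G\<^sup>T *\<^sub>v v\<close> with
  \<open>v\<close> nonzero. Such a word lies in the dual iff \<open>G * G\<^sup>T\<close> kills
  \<open>v\<close>, so a nonzero word in the intersection exists iff the Gram matrix is
  singular.\<close>

lemma euclidean_LCD_row_space_iff:
  fixes G :: "'a :: field mat"
  assumes G: "G \<in> carrier_mat n N"
    and inj: "\<And>v. v \<in> carrier_vec n \<Longrightarrow> G\<^sup>T *\<^sub>v v = 0\<^sub>v N \<Longrightarrow> v = 0\<^sub>v n"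
  shows "euclidean_LCD N (code_of_generator_mat G) \<longleftrightarrow> det (G * G\<^sup>T) \<noteq> 0"
proof -
  have GT: "G\<^sup>T \<in> carrier_mat N n" using G by simp
  have GG: "G * G\<^sup>T \<in> carrier_mat n n" using G by simp
  have C: "code_of_generator_mat G = (\<lambda>y. G\<^sup>T *\<^sub>v y) ` carrier_vec n"
    using G vec_space.row_space_eq[OF G] by (auto simp: code_of_generator_mat_def)
  have dual: "G\<^sup>T *\<^sub>v v \<in> euclidean_dual N (code_of_generator_mat G) \<longleftrightarrow> (G * G\<^sup>T) *\<^sub>v v = 0\<^sub>v n"
    if v: "v \<in> carrier_vec n" for v
  proof -
    define w where "w = G\<^sup>T *\<^sub>v v"
    have w: "w \<in> carrier_vec N" using GT v by (simp add: w_def)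
    \<comment> \<open>Adjointness: orthogonality of \<open>w\<close> to all codewords becomes
      orthogonality of \<open>G *\<^sub>v w\<close> to all vectors.\<close>
    have "w \<bullet> (G\<^sup>T *\<^sub>v y) = (G *\<^sub>v w) \<bullet> y" if "y \<in> carrier_vec n" for y
      using transpose_vec_mult_scalar[OF GT that w] w G that GT
      by (simp add: comm_scalar_prod[of w N] comm_scalar_prod[of "G *\<^sub>v w" n])
    then have "w \<in> euclidean_dual N (code_of_generator_mat G) \<longleftrightarrow>
        (\<forall>y\<in>carrier_vec n. (G *\<^sub>v w) \<bullet> y = 0)"
      using w by (auto simp: C vec_module.orthogonal_complement_def)
    also have "\<dots> \<longleftrightarrow> G *\<^sub>v w = 0\<^sub>v n"
    proof
      assume *: "\<forall>y\<in>carrier_vec n. (G *\<^sub>v w) \<bullet> y = 0"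
      show "G *\<^sub>v w = 0\<^sub>v n"
      proof (rule eq_vecI)
        fix i assume i: "i < dim_vec (0\<^sub>v n :: 'a vec)"
        \<comment> \<open>Testing against unit vectors reads off the coordinates.\<close>
        then have "(G *\<^sub>v w) \<bullet> unit_vec n i = 0" by (intro bspec[OF *]) simp
        then show "(G *\<^sub>v w) $ i = 0\<^sub>v n $ i"
          using i mult_mat_vec_carrier[OF G w] by (simp add: scalar_prod_right_unit)
      qed (use G in auto)
    qed auto
    also have "G *\<^sub>v w = (G * G\<^sup>T) *\<^sub>v v"
      unfolding w_def using assoc_mult_mat_vec[OF G GT v] by simp
    finally show ?thesis by (simp add: w_def)
  qed
  have mult_0: "M *\<^sub>v 0\<^sub>v k = 0\<^sub>v m" if "M \<in> carrier_mat m k" for M :: "'a mat" and m k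
    using that by auto
  note GT0 = mult_0[OF GT]
  have "det (G * G\<^sup>T) = 0 \<longleftrightarrow> (\<exists>v\<in>carrier_vec n. v \<noteq> 0\<^sub>v n \<and> (G * G\<^sup>T) *\<^sub>v v = 0\<^sub>v n)"
    using det_0_iff_vec_prod_zero_field[OF GG] by auto
  also have "\<dots> \<longleftrightarrow> (\<exists>v\<in>carrier_vec n. G\<^sup>T *\<^sub>v v \<noteq> 0\<^sub>v N \<and>
      G\<^sup>T *\<^sub>v v \<in> euclidean_dual N (code_of_generator_mat G))"
  proof (rule bex_cong[OF refl])
    fix v :: "'a vec" assume v: "v \<in> carrier_vec n"
    then have "v \<noteq> 0\<^sub>v n \<longleftrightarrow> G\<^sup>T *\<^sub>v v \<noteq> 0\<^sub>v N"
      using inj GT0 by blast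
    then show "v \<noteq> 0\<^sub>v n \<and> (G * G\<^sup>T) *\<^sub>v v = 0\<^sub>v n \<longleftrightarrow> G\<^sup>T *\<^sub>v v \<noteq> 0\<^sub>v N \<and>
        G\<^sup>T *\<^sub>v v \<in> euclidean_dual N (code_of_generator_mat G)"
      unfolding dual[OF v] by simp
  qed
  finally have *: "det (G * G\<^sup>T) = 0 \<longleftrightarrow>
      \<not> code_of_generator_mat G \<inter> euclidean_dual N (code_of_generator_mat G) \<subseteq> {0\<^sub>v N}"
    by (auto simp: C)
  \<comment> \<open>\<open>*\<close> speaks only of inclusion in the zero set; LCD asks for
    equality, so zero must be placed in the intersection.\<close>
  have "0\<^sub>v N \<in> code_of_generator_mat G \<inter> euclidean_dual N (code_of_generator_mat G)"
  proof
    show "0\<^sub>v N \<in> code_of_generator_mat G"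
      unfolding C using GT0 by (intro image_eqI[of _ _ "0\<^sub>v n"]) simp_all
    show "0\<^sub>v N \<in> euclidean_dual N (code_of_generator_mat G)"
      using dual[OF zero_carrier_vec] mult_0[OF GG] unfolding GT0 by blast
  qed
  then have "code_of_generator_mat G \<inter> euclidean_dual N (code_of_generator_mat G) \<subseteq> {0\<^sub>v N} \<longleftrightarrow>
      euclidean_LCD N (code_of_generator_mat G)"
    unfolding euclidean_LCD_def by (simp only: set_eq_subset insert_subset empty_subsetI simp_thms)
  with * show ?thesis by simp
qed

section \<open>The block generator matrix\<close>

lemma poly_block_mat_carrier:
  "A \<in> carrier_mat n n \<Longrightarrow> poly_block_mat t f A \<in> carrier_mat n (t * n)"
  by (auto simp: poly_block_mat_def Let_def)

text \<open>The identity block is the value of the constant polynomial 1, so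
  \<open>f(0 := 1)\<close> describes all blocks uniformly; column \<open>m + b * n\<close> is column
  \<open>m\<close> of block \<open>b\<close>.\<close>

lemma index_poly_block_mat:
  assumes A: "A \<in> carrier_mat n n" and "i < n" "m < n" "b < t"
  shows "poly_block_mat t f A $$ (i, m + b * n) = mat_poly_eval ((f(0 := 1)) b) A $$ (i, m)"
proof -
  have "m + b * n < Suc b * n" using \<open>m < n\<close> by simp
  also have "\<dots> \<le> t * n" using \<open>b < t\<close> by (intro mult_right_mono) auto
  finally show ?thesis
    using assms by (auto simp: poly_block_mat_def mat_poly_eval_1[OF A])
qed

text \<open>Grouping columns by block gives the sum of each block times its transpose. The blocks
  are symmetric, so each summand is the value of a squared polynomial.\<close>

lemma poly_block_mat_times_transpose:
  assumes A: "A \<in> carrier_mat n n" and sym: "A\<^sup>T = A"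
  shows "poly_block_mat t f A * (poly_block_mat t f A)\<^sup>T =
    mat_poly_eval (\<Sum>b<t. ((f(0 := 1)) b)\<^sup>2) A" (is "?G * ?G\<^sup>T = mat_poly_eval ?g A")
proof (rule eq_matI)
  have G: "?G \<in> carrier_mat n (t * n)" by (rule poly_block_mat_carrier[OF A])
  let ?B = "\<lambda>b. mat_poly_eval ((f(0 := 1)) b) A"
  have B: "?B b \<in> carrier_mat n n" for b by (rule mat_poly_eval_carrier[OF A])
  fix i j assume "i < dim_row (mat_poly_eval ?g A)" "j < dim_col (mat_poly_eval ?g A)"
  then have ij: "i < n" "j < n"
    using mat_poly_eval_carrier[OF A, of ?g] by auto
  have BB: "(\<Sum>m<n. ?B b $$ (i, m) * ?B b $$ (j, m)) = mat_poly_eval (((f(0 := 1)) b)\<^sup>2) A $$ (i, j)" for b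
  proof -
    have "mat_poly_eval (((f(0 := 1)) b)\<^sup>2) A = ?B b * (?B b)\<^sup>T"
      unfolding power2_eq_square mat_poly_eval_mult[OF A] transpose_mat_poly_eval[OF A] sym ..
    then show ?thesis
      using ij A by (simp del: fun_upd_apply add: scalar_prod_def atLeast0LessThan)
  qed
  \<comment> \<open>Columns of block \<open>b\<close> are reindexed by their offset within the
    block.\<close>
  have shift: "(\<Sum>c=b * n..<b * n + n. h c) = (\<Sum>m<n. h (m + b * n))" for b and h :: "nat \<Rightarrow> 'a"
    using sum.shift_bounds_nat_ivl[of h 0 "b * n" n] by (simp add: atLeast0LessThan add.commute[of n])
  have "(?G * ?G\<^sup>T) $$ (i, j) = (\<Sum>c<t * n. ?G $$ (i, c) * ?G $$ (j, c))"
    using G ij by (simp add: scalar_prod_def atLeast0LessThan)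
  also have "\<dots> = (\<Sum>b<t. \<Sum>c=b * n..<b * n + n. ?G $$ (i, c) * ?G $$ (j, c))"
    by (rule sum.nat_group[symmetric])
  also have "\<dots> = (\<Sum>b<t. \<Sum>m<n. ?G $$ (i, m + b * n) * ?G $$ (j, m + b * n))"
    by (simp only: shift)
  also have "\<dots> = (\<Sum>b<t. \<Sum>m<n. ?B b $$ (i, m) * ?B b $$ (j, m))"
    using ij by (intro sum.cong refl) (simp del: fun_upd_apply add: index_poly_block_mat[OF A])
  also have "\<dots> = mat_poly_eval ?g A $$ (i, j)"
    unfolding BB index_mat_poly_eval_sum[OF A ij] ..
  finally show "(?G * ?G\<^sup>T) $$ (i, j) = mat_poly_eval ?g A $$ (i, j)" .
qed (use poly_block_mat_carrier[OF A, of t f] A in auto)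

text \<open>Block 0 is the identity, so the first \<open>n\<close> entries of the product are those
  of \<open>v\<close>.\<close>

lemma poly_block_mat_transpose_inj:
  fixes A :: "'a :: comm_ring_1 mat"
  assumes A: "A \<in> carrier_mat n n" and "t \<ge> 1" and v: "v \<in> carrier_vec n"
    and 0: "(poly_block_mat t f A)\<^sup>T *\<^sub>v v = 0\<^sub>v (t * n)"
  shows "v = 0\<^sub>v n"
proof (rule eq_vecI)
  fix i assume "i < dim_vec (0\<^sub>v n :: 'a vec)"
  then have i: "i < n" by simp
  then have it: "i < t * n"
    using \<open>t \<ge> 1\<close> by (metis less_le_trans mult_le_mono1 nat_mult_1)
  have "0 = ((poly_block_mat t f A)\<^sup>T *\<^sub>v v) $ i"
    using 0 it by simp
  also have "\<dots> = (\<Sum>m<n. poly_block_mat t f A $$ (m, i) * v $ m)"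
    using poly_block_mat_carrier[OF A, of t f] it v
    by (simp add: scalar_prod_def atLeast0LessThan)
  also have "\<dots> = (\<Sum>m<n. if m = i then v $ m else 0)"
    using i \<open>t \<ge> 1\<close> index_poly_block_mat[OF A _ i, of _ 0 t f]
    by (intro sum.cong refl) (auto simp: mat_poly_eval_1[OF A])
  finally show "v $ i = 0\<^sub>v n $ i" using i by simp
qed (use v in auto)

text \<open>The Gram matrix is the value at \<open>A\<close> of one polynomial \<open>g\<close>,
  invertible iff \<open>g\<close> vanishes at no eigenvalue. All parts of the theorem are read off
  from this form.\<close>

lemma euclidean_LCD_poly_block_iff:
  fixes A :: "'a :: field mat"
  assumes "n \<ge> 1" "t \<ge> 1" and A: "A \<in> carrier_mat n n" "A\<^sup>T = A" and l: "eigenvalues_listed A l"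
  shows "euclidean_LCD (t * n) (code_of_generator_mat (poly_block_mat t f A)) \<longleftrightarrow>
    (\<forall>i. 1 \<le> i \<and> i \<le> n \<longrightarrow> 1 + (\<Sum>k=1..t-1. (poly_ac (f k) (l i))\<^sup>2) \<noteq> 0)"
proof -
  define g where "g = (\<Sum>b<t. ((f(0 := 1)) b)\<^sup>2)"
  \<comment> \<open>Block 0 is split off: its square supplies the leading 1 of
    \<open>g\<close>.\<close>
  have "{..<t} = insert 0 {1..t-1}" using \<open>t \<ge> 1\<close> by auto
  then have "g = 1 + (\<Sum>k=1..t-1. (f k)\<^sup>2)"
    by (simp add: g_def)
  then have g: "poly_ac g x = 1 + (\<Sum>k=1..t-1. (poly_ac (f k) x)\<^sup>2)" for x
    by (simp add: hom_distribs to_ac_poly.hom_sum poly_sum)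
  have "euclidean_LCD (t * n) (code_of_generator_mat (poly_block_mat t f A)) \<longleftrightarrow>
      det (mat_poly_eval g A) \<noteq> 0"
    unfolding g_def poly_block_mat_times_transpose[OF A, symmetric]
    by (intro euclidean_LCD_row_space_iff[OF poly_block_mat_carrier[OF A(1)]]
        poly_block_mat_transpose_inj[OF A(1) \<open>t \<ge> 1\<close>])
  then show ?thesis
    by (auto simp: det_mat_poly_eval_eq_0_iff_listed[OF A(1) \<open>n \<ge> 1\<close> l] g)
qed

section \<open>Squares in characteristic two and square roots of -1\<close>

text \<open>All cross terms carry a factor 2.\<close>

lemma sum_square_CHAR_2:
  fixes x :: "'b \<Rightarrow> 'a :: comm_ring_1"
  assumes "(2 :: 'a) = 0"
  shows "(\<Sum>k\<in>K. (x k)\<^sup>2) = (\<Sum>k\<in>K. x k)\<^sup>2"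
  using assms
  by (induction K rule: infinite_finite_induct) (auto simp: power2_sum)

text \<open>Negation permutes the nonzero elements, so their product \<open>P\<close> absorbs one
  sign per element; cancelling \<open>P\<close> gives (-1)^(q-1) = 1, for even and odd q
  alike.\<close>

lemma finite_field_minus_one_power_card: "(- 1 :: 'a :: {field, finite}) ^ CARD('a) = - 1"
proof -
  define P where "P = (\<Prod>x\<in>UNIV - {0 :: 'a}. x)"
  have "P \<noteq> 0" by (simp add: P_def)
  have "P = (\<Prod>x\<in>UNIV - {0 :: 'a}. - x)"
    unfolding P_def by (rule prod.reindex_bij_witness[of _ uminus uminus]) auto
  also have "\<dots> = (- 1) ^ (CARD('a) - 1) * P"
    by (simp add: P_def prod_uminus)
  finally have "(- 1 :: 'a) ^ (CARD('a) - 1) = 1"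
    using \<open>P \<noteq> 0\<close> by simp
  then show ?thesis
    using power_minus_mult[of "CARD('a)" "- 1 :: 'a"] by simp
qed

text \<open>With q the field size, \<mu>^q is again a square root of -1, hence \<mu> or -\<mu>; a
  second q-th power returns \<mu> in either case.\<close>

lemma sqrt_minus_one_in_quadratic_extension:
  fixes \<mu> :: "'a :: {field, finite} alg_closure"
  assumes \<mu>: "\<mu>\<^sup>2 = - 1"
  shows "\<mu> \<in> quadratic_extension"
proof -
  let ?q = "CARD('a)"
  have m1: "(- 1 :: 'a alg_closure) ^ ?q = - 1"
    using arg_cong[OF finite_field_minus_one_power_card[where 'a='a], of to_ac]
    by (simp del: power_minus_odd)
  have "(\<mu> ^ ?q)\<^sup>2 = (\<mu>\<^sup>2) ^ ?q"
    by (simp only: power_mult[symmetric] mult.commute)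
  also have "\<dots> = \<mu>\<^sup>2"
    unfolding \<mu> by (rule m1)
  finally have "(\<mu> ^ ?q)\<^sup>2 = \<mu>\<^sup>2" .
  then consider "\<mu> ^ ?q = \<mu>" | "\<mu> ^ ?q = - \<mu>"
    by (auto simp: power2_eq_iff)
  then have "(\<mu> ^ ?q) ^ ?q = \<mu>"
  proof cases
    case 2
    then show ?thesis
      using m1 by (simp add: power_minus[of \<mu>])
  qed simp
  then show ?thesis
    by (simp add: quadratic_extension_def power2_eq_square power_mult)
qed

theorem theorem3p3:
  fixes A :: "'a :: {field, finite} mat"
    and f :: "nat \<Rightarrow> 'a poly"
    and l :: "nat \<Rightarrow> 'a alg_closure"
    and n t :: nat
    and C :: "'a vec set"
  assumes "n \<ge> 1" and "t \<ge> 2"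
    and "A \<in> carrier_mat n n" and "transpose_mat A = A"
    and "eigenvalues_listed A l"
    and "C = code_of_generator_mat (poly_block_mat t f A)"
  shows
    "(even CHAR('a) \<longrightarrow>
        (euclidean_LCD (t * n) C \<longleftrightarrow>
           1 \<notin> {\<Sum>k=1..t-1. poly_ac (f k) (l i) | i. 1 \<le> i \<and> i \<le> n})) \<and>
     (odd CHAR('a) \<longrightarrow>
        (euclidean_LCD (t * n) C \<longleftrightarrow>
           - 1 \<notin> {\<Sum>k=1..t-1. (poly_ac (f k) (l i))\<^sup>2 | i. 1 \<le> i \<and> i \<le> n})) \<and>
     (t = 2 \<and> odd CHAR('a) \<longrightarrow>
        (\<exists>\<mu> \<in> (quadratic_extension :: 'a alg_closure set). \<mu>\<^sup>2 = - 1) \<and>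
        (\<forall>\<mu> \<in> (quadratic_extension :: 'a alg_closure set). \<mu>\<^sup>2 = - 1 \<longrightarrow>
           (euclidean_LCD (t * n) C \<longleftrightarrow>
              \<mu> \<notin> {poly_ac (f 1) (l i) | i. 1 \<le> i \<and> i \<le> n} \<union>
                  {- poly_ac (f 1) (l i) | i. 1 \<le> i \<and> i \<le> n})))"
proof -
  let ?L = "\<forall>i. 1 \<le> i \<and> i \<le> n \<longrightarrow> 1 + (\<Sum>k=1..t-1. (poly_ac (f k) (l i))\<^sup>2) \<noteq> 0"
  have LCD: "euclidean_LCD (t * n) C \<longleftrightarrow> ?L"
    unfolding assms(6) by (rule euclidean_LCD_poly_block_iff) (use assms in auto)
  \<comment> \<open>The summand 1 of \<open>?L\<close> moves to the other side; the even case and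
    the case of two blocks start from this form.\<close>
  have odd: "euclidean_LCD (t * n) C \<longleftrightarrow>
      - 1 \<notin> {\<Sum>k=1..t-1. (poly_ac (f k) (l i))\<^sup>2 | i. 1 \<le> i \<and> i \<le> n}"
  proof -
    have "1 + s \<noteq> 0 \<longleftrightarrow> - 1 \<noteq> s" for s :: "'a alg_closure"
      by (metis add_eq_0_iff)
    then show ?thesis unfolding LCD by blast
  qed
  have even: "euclidean_LCD (t * n) C \<longleftrightarrow>
      1 \<notin> {\<Sum>k=1..t-1. poly_ac (f k) (l i) | i. 1 \<le> i \<and> i \<le> n}" if "even CHAR('a)"
  proof -
    \<comment> \<open>The characteristic of a finite field is prime, so if even it equals 2.\<close>
    have "(of_nat 2 :: 'a) = 0"
      using that prime_CHAR_semidom[where 'a='a, OF finite_imp_CHAR_pos[OF finite_class.finite_UNIV]]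
      by (metis of_nat_CHAR primes_dvd_imp_eq two_is_prime_nat)
    then have "to_ac (of_nat 2 :: 'a) = 0" by simp
    then have two: "(2 :: 'a alg_closure) = 0" by simp
    then have "(- 1 :: 'a alg_closure) = 1"
      by (metis add.inverse_unique one_add_one)
    \<comment> \<open>The sum of squares is the square of the sum s, and s^2 = 1 means s = 1 or s =
      -1, which coincide here.\<close>
    then have "- 1 = (\<Sum>k=1..t-1. (poly_ac (f k) (l i))\<^sup>2) \<longleftrightarrow> 1 = (\<Sum>k=1..t-1. poly_ac (f k) (l i))" for i
      unfolding sum_square_CHAR_2[OF two] by (metis power2_eq_1_iff)
    then show ?thesis unfolding odd by auto
  qed
  have "\<exists>\<mu> :: 'a alg_closure. \<mu>\<^sup>2 = - 1"
    using nth_root_exists[of 2 "- 1 :: 'a alg_closure"] by auto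
  then have ex: "\<exists>\<mu> \<in> (quadratic_extension :: 'a alg_closure set). \<mu>\<^sup>2 = - 1"
    using sqrt_minus_one_in_quadratic_extension by blast
  have mu: "euclidean_LCD (t * n) C \<longleftrightarrow>
      \<mu> \<notin> {poly_ac (f 1) (l i) | i. 1 \<le> i \<and> i \<le> n} \<union> {- poly_ac (f 1) (l i) | i. 1 \<le> i \<and> i \<le> n}"
    if "t = 2" "\<mu>\<^sup>2 = - 1" for \<mu>
  proof -
    \<comment> \<open>For \<open>t = 2\<close> the sum has one term; writing -1 as \<mu>^2 compares
      two squares, hence the two signs.\<close>
    have "- 1 = (poly_ac (f 1) (l i))\<^sup>2 \<longleftrightarrow> \<mu> = poly_ac (f 1) (l i) \<or> \<mu> = - poly_ac (f 1) (l i)" for i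
      unfolding that(2)[symmetric] by (rule power2_eq_iff)
    then show ?thesis unfolding odd using \<open>t = 2\<close> by auto
  qed
  show ?thesis
    by (intro conjI impI ballI ex) (erule even, rule odd, rule mu, simp_all)
qed

end
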